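(* Let $a,b,c,d\in\mathcal M_n$ be such that each of $a,b$ alternates strongly with each of $c,d$, $(a,b)(c,d)=0$ in $\mathcal M_{n+1}$, and $n(a)=n(b)=n(c)=n(d)=1$. Let $e_0$ be the unity of $\mathcal M_n$, and define the following elements of $\mathcal M_{n+1}$: $$\begin{array}{llll} f_0=(e_0,0), & f_5=(c,d), & \tilde f_0=(0,e_0), & \tilde f_5=(-d,c),\\ f_1=(a,b), & f_6=(a,-b), & \tilde f_1=(-b,a), & \tilde f_6=(b,a),\\ f_2=(c,-d), & f_7=(0,ab), & \tilde f_2=(d,c), & \tilde f_7=(-ab,0),\\ f_3=(ac,ad), & f_8=(0,dc), & \tilde f_3=(-ad,ac), & \tilde f_8=(-dc,0),\\ f_4=(ac,-ad), & f_9=(0,(ac)(ad)), & \tilde f_4=(ad,ac), & \tilde f_9=(-(ac)(ad),0). \end{array}$$ Then $F=\{f_m,\tilde f_m\mid m=0,\dots,6\}$ is an orthogonal system in $\mathcal M_{n+1}$ with respect to the inner product $\langle\cdot,\cdot\rangle$, and its multiplication table is the following (the entry in row $x$ and column $y$ is the product $xy$): $$\begin{array}{c|ccccccc|ccccccc} \times & f_0 & f_1 & f_2 & f_3 & f_4 & f_5 & f_6 & \tilde f_0 & \tilde f_1 & \tilde f_2 & \tilde f_3 & \tilde f_4 & \tilde f_5 & \tilde f_6\\ \hline f_0 & f_0 & f_1 & f_2 & f_3 & f_4 & f_5 & f_6 & \tilde f_0 & \tilde f_1 & \tilde f_2 & \tilde f_3 & \tilde f_4 & \tilde f_5 & \tilde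 f_6\\ f_1 & f_1 & -2f_0 & 2f_3 & -2f_2 & 0 & 0 & 2f_7 & \tilde f_1 & -2\tilde f_0 & -2\tilde f_3 & 2\tilde f_2 & 0 & 0 & -2\tilde f_7\\ f_2 & f_2 & -2f_3 & -2f_0 & 2f_1 & 0 & 2f_8 & 0 & \tilde f_2 & 2\tilde f_3 & -2\tilde f_0 & -2\tilde f_1 & 0 & -2\tilde f_8 & 0\\ f_3 & f_3 & 2f_2 & -2f_1 & -2f_0 & 2f_9 & 0 & 0 & \tilde f_3 & -2\tilde f_2 & 2\tilde f_1 & -2\tilde f_0 & -2\tilde f_9 & 0 & 0\\ f_4 & f_4 & 0 & 0 & -2f_9 & -2f_0 & -2f_6 & 2f_5 & \tilde f_4 & 0 & 0 & 2\tilde f_9 & -2\tilde f_0 & 2\tilde f_6 & -2\tilde f_5\\ f_5 & f_5 & 0 & -2f_8 & 0 & 2f_6 & -2f_0 & -2f_4 & \tilde f_5 & 0 & 2\tilde f_8 & 0 & -2\tilde f_6 & -2\tilde f_0 & 2\tilde f_4\\ f_6 & f_6 & -2f_7 & 0 & 0 & -2f_5 & 2f_4 & -2f_0 & \tilde f_6 & 2\tilde f_7 & 0 & 0 & 2\tilde f_5 & -2\tilde f_4 & -2\tilde f_0\\ \hline \tilde f_0 & \tilde f_0 & -\tilde f_1 & -\tilde f_2 & -\tilde f_3 & -\tilde f_4 & -\tilde f_5 & -\tilde f_6 & -f_0 & f_1 & f_2 & f_3 & f_4 & f_5 & f_6\\ \tilde f_1 & \tilde f_1 & 2\tilde f_0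 & -2\tilde f_3 & 2\tilde f_2 & 0 & 0 & -2\tilde f_7 & -f_1 & -2f_0 & -2f_3 & 2f_2 & 0 & 0 & -2f_7\\ \tilde f_2 & \tilde f_2 & 2\tilde f_3 & 2\tilde f_0 & -2\tilde f_1 & 0 & -2\tilde f_8 & 0 & -f_2 & 2f_3 & -2f_0 & -2f_1 & 0 & -2f_8 & 0\\ \tilde f_3 & \tilde f_3 & -2\tilde f_2 & 2\tilde f_1 & 2\tilde f_0 & -2\tilde f_9 & 0 & 0 & -f_3 & -2f_2 & 2f_1 & -2f_0 & -2f_9 & 0 & 0\\ \tilde f_4 & \tilde f_4 & 0 & 0 & 2\tilde f_9 & 2\tilde f_0 & 2\tilde f_6 & -2\tilde f_5 & -f_4 & 0 & 0 & 2f_9 & -2f_0 & 2f_6 & -2f_5\\ \tilde f_5 & \tilde f_5 & 0 & 2\tilde f_8 & 0 & -2\tilde f_6 & 2\tilde f_0 & 2\tilde f_4 & -f_5 & 0 & 2f_8 & 0 & -2f_6 & -2f_0 & 2f_4\\ \tilde f_6 & \tilde f_6 & 2\tilde f_7 & 0 & 0 & 2\tilde f_5 & -2\tilde f_4 & 2\tilde f_0 & -f_6 & 2f_7 & 0 & 0 & 2f_5 & -2f_4 & -2f_0 \end{array}$$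
   Context: The algebras of the main sequence: $\mathcal M_0=\mathbb R$ with trivial involution, and $\mathcal M_{k+1}=\mathcal M_k\times\mathcal M_k$ with componentwise addition and real scaling, product $(a,b)(c,d)=(ac-\bar d b,\ da+b\bar c)$ and involution $\overline{(a,b)}=(\bar a,-b)$. The norm is $n(a)=a\bar a\in\mathbb R$, and $\langle x,y\rangle=\frac12(x\bar y+y\bar x)$ is the associated (Euclidean) inner product. Two elements $x,y$ alternate strongly if $(xx)y=x(xy)$ and $(yy)x=y(yx)$. *)

theory Defs
  imports Complex_Main
begin

text \<open>
  The Cayley--Dickson algebras of the main sequence. The dimension of \<open>\<M>\<^sub>n\<close> is
  \<open>2 ^ n\<close> with \<open>n\<close> ranging over all naturals inside one statement, so their elements are binary
  trees with real leaves, and \<open>\<M>\<^sub>n\<close> is the set of complete trees of height \<open>n\<close>.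
  \<open>CD_Pair x y\<close> is the pair \<open>(x, y)\<close>.
\<close>

datatype cd = CD_Real real | CD_Pair cd cd

primrec cd_algebra :: "nat \<Rightarrow> cd set" where
  "cd_algebra 0 = range CD_Real"
| "cd_algebra (Suc k) = {CD_Pair x y | x y. x \<in> cd_algebra k \<and> y \<in> cd_algebra k}"

primrec cd_zero :: "nat \<Rightarrow> cd" where
  "cd_zero 0 = CD_Real 0"
| "cd_zero (Suc k) = CD_Pair (cd_zero k) (cd_zero k)"

primrec cd_one :: "nat \<Rightarrow> cd" where
  "cd_one 0 = CD_Real 1"
| "cd_one (Suc k) = CD_Pair (cd_one k) (cd_zero k)"

instantiation cd :: "{uminus, plus, minus, scaleR}"
begin

primrec uminus_cd :: "cd \<Rightarrow> cd" where
  "uminus_cd (CD_Real r) = CD_Real (- r)"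
| "uminus_cd (CD_Pair a b) = CD_Pair (uminus_cd a) (uminus_cd b)"

text \<open>
  Binary operations are only specified on trees of the same shape, in particular on each
  \<open>\<M>\<^sub>n\<close>; no other arguments are ever relevant.
\<close>

fun plus_cd :: "cd \<Rightarrow> cd \<Rightarrow> cd" where
  "plus_cd (CD_Real r) (CD_Real s) = CD_Real (r + s)"
| "plus_cd (CD_Pair a b) (CD_Pair c d) = CD_Pair (plus_cd a c) (plus_cd b d)"

definition minus_cd :: "cd \<Rightarrow> cd \<Rightarrow> cd" where
  "minus_cd x y = x + (- y)"

primrec scaleR_cd :: "real \<Rightarrow> cd \<Rightarrow> cd" where
  "scaleR_cd t (CD_Real r) = CD_Real (t * r)"
| "scaleR_cd t (CD_Pair a b) = CD_Pair (scaleR_cd t a) (scaleR_cd t b)"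

instance ..

end

primrec cd_conj :: "cd \<Rightarrow> cd" where
  "cd_conj (CD_Real r) = CD_Real r"
| "cd_conj (CD_Pair a b) = CD_Pair (cd_conj a) (- b)"

lemma size_cd_uminus [simp]: "size (- x :: cd) = size x"
  by (induction x) auto

lemma size_cd_conj [simp]: "size (cd_conj x) = size x"
  by (induction x) auto

instantiation cd :: times
begin

function times_cd :: "cd \<Rightarrow> cd \<Rightarrow> cd" where
  "times_cd (CD_Real r) (CD_Real s) = CD_Real (r * s)"
| "times_cd (CD_Pair a b) (CD_Pair c d) =
     CD_Pair (times_cd a c - times_cd (cd_conj d) b) (times_cd d a + times_cd b (cd_conj c))"
| "times_cd (CD_Real r) (CD_Pair c d) = undefined"
| "times_cd (CD_Pair a b) (CD_Real s) = undefined"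
  by pat_completeness auto
termination
  by (relation "measure (\<lambda>(x, y). size x + size y)") auto

instance ..

end

text \<open>
  The reals are identified with the real multiples of the unity \<open>e\<^sub>0\<close> of \<open>\<M>\<^sub>n\<close>. The norm
  \<open>n(x)\<close> and the inner product are thus given as elements of \<open>\<M>\<^sub>n\<close>; \<open>n(x) = 1\<close> reads
  \<open>cd_norm x = cd_one n\<close>, and orthogonality of \<open>x\<close> and \<open>y\<close> reads
  \<open>cd_inner x y = cd_zero n\<close>.
\<close>

definition cd_norm :: "cd \<Rightarrow> cd" where
  "cd_norm x = x * cd_conj x"

definition cd_inner :: "cd \<Rightarrow> cd \<Rightarrow> cd" where
  "cd_inner x y = (1 / 2) *\<^sub>R (x * cd_conj y + y * cd_conj x)"

definition alternate_strongly :: "cd \<Rightarrow> cd \<Rightarrow> bool" where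
  "alternate_strongly x y \<longleftrightarrow> (x * x) * y = x * (x * y) \<and> (y * y) * x = y * (y * x)"

text \<open>
  The system is given as a list, so that pairwise orthogonality is required at any two distinct
  positions; with all members nonzero, the members are in particular pairwise distinct.
\<close>

definition cd_orthogonal_system :: "nat \<Rightarrow> cd list \<Rightarrow> bool" where
  "cd_orthogonal_system n xs \<longleftrightarrow>
     set xs \<subseteq> cd_algebra n \<and> cd_zero n \<notin> set xs \<and>
     (\<forall>i < length xs. \<forall>j < length xs. i \<noteq> j \<longrightarrow> cd_inner (xs ! i) (xs ! j) = cd_zero n)"

end

theory Submission
  imports Defs
begin

text \<open>
  The real part is a symmetric trace with \<open>Re ((xy)z) = Re (x(yz))\<close>. The equation \<open>(a, b)(c, d) = 0\<close>
  says \<open>ac = d\<^sup>* b\<close> and \<open>da = - b c\<^sup>*\<close>, with \<open>\<^sup>*\<close> the involution. Evaluating traces such as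
  \<open>Re b = Re (d(ac)) = Re ((da)c) = - Re b\<close>, the norms being 1, shows that \<open>a, b, c, d\<close> are purely imaginary.
  Then strong alternation and the trace show that \<open>a, b, c, d\<close> are pairwise orthogonal
  and hence anticommute, and that the same holds for \<open>ac, ad\<close>. So every product of two of
  \<open>a, b, c, d, ac, ad\<close> is, up to sign, the unity, one of these six, or one of \<open>ab\<close>, \<open>dc\<close>,
  \<open>(ac)(ad)\<close>, and both the table and the orthogonality can be read off componentwise.
\<close>

section \<open>Linear structure\<close>

lemma cd_add_closed [simp]: "x \<in> cd_algebra n \<Longrightarrow> y \<in> cd_algebra n \<Longrightarrow> x + y \<in> cd_algebra n"
  by (induction n arbitrary: x y) fastforce+

lemma cd_minus_closed [simp]: "x \<in> cd_algebra n \<Longrightarrow> - x \<in> cd_algebra n"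
  by (induction n arbitrary: x) fastforce+

lemma cd_diff_closed [simp]: "x \<in> cd_algebra n \<Longrightarrow> y \<in> cd_algebra n \<Longrightarrow> x - y \<in> cd_algebra n"
  by (simp add: minus_cd_def)

lemma cd_zero_closed [simp]: "cd_zero n \<in> cd_algebra n"
  by (induction n) auto

lemma cd_one_closed [simp]: "cd_one n \<in> cd_algebra n"
  by (induction n) auto

lemma cd_conj_closed [simp]: "x \<in> cd_algebra n \<Longrightarrow> cd_conj x \<in> cd_algebra n"
  by (induction n arbitrary: x) fastforce+

lemma cd_times_closed [simp]: "x \<in> cd_algebra n \<Longrightarrow> y \<in> cd_algebra n \<Longrightarrow> x * y \<in> cd_algebra n"
proof (induction n arbitrary: x y)
  case (Suc n)
  then show ?case by auto
qed auto

text \<open>No carrier is needed: trees of different shape have the same junk sum in either order.\<close>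

lemma cd_add_commute: "x + y = y + (x :: cd)"
proof (induction x y rule: plus_cd.induct)
  have junk: "CD_Pair p q + CD_Real r = undefined" "CD_Real r + CD_Pair p q = undefined" for p q r
    by (rule plus_cd.elims[OF refl]; simp)+
  show "CD_Pair p q + CD_Real r = CD_Real r + CD_Pair p q"
    "CD_Real r + CD_Pair p q = CD_Pair p q + CD_Real r" for p q r
    by (simp_all add: junk)
qed auto

lemma cd_add_assoc:
  "x \<in> cd_algebra n \<Longrightarrow> y \<in> cd_algebra n \<Longrightarrow> z \<in> cd_algebra n \<Longrightarrow> x + y + z = x + (y + z)"
  by (induction n arbitrary: x y z) fastforce+

lemma cd_add_left_commute:
  "x \<in> cd_algebra n \<Longrightarrow> y \<in> cd_algebra n \<Longrightarrow> z \<in> cd_algebra n \<Longrightarrow> x + (y + z) = y + (x + z)"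
  by (metis cd_add_assoc cd_add_commute)

lemma cd_add_zero [simp]: "x \<in> cd_algebra n \<Longrightarrow> x + cd_zero n = x"
  by (induction n arbitrary: x) fastforce+

lemma cd_zero_add [simp]: "x \<in> cd_algebra n \<Longrightarrow> cd_zero n + x = x"
  by (simp add: cd_add_commute)

lemma cd_add_minus: "x \<in> cd_algebra n \<Longrightarrow> x + - x = cd_zero n"
  by (induction n arbitrary: x) fastforce+

lemma cd_minus_add: "x \<in> cd_algebra n \<Longrightarrow> - x + x = cd_zero n"
  by (simp add: cd_add_commute cd_add_minus)

lemma cd_minus_minus [simp]: "- (- x) = (x :: cd)"
  by (induction x) auto

lemma cd_eq_minus_iff: "x = - y \<longleftrightarrow> - x = (y :: cd)"
  by auto

lemma cd_minus_zero [simp]: "- cd_zero n = cd_zero n"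
  by (induction n) auto

lemma cd_minus_distrib: "x \<in> cd_algebra n \<Longrightarrow> y \<in> cd_algebra n \<Longrightarrow> - (x + y) = - x + - y"
  by (induction n arbitrary: x y) fastforce+

text \<open>Uniqueness of additive inverses inside one carrier. The sign rules for products and the
  relations hidden in a vanishing product of pairs are drawn from it.\<close>

lemma cd_eq_minus_if_add_zero:
  assumes "x \<in> cd_algebra n" "y \<in> cd_algebra n" "x + y = cd_zero n"
  shows "x = - y"
  by (metis assms cd_add_assoc cd_add_minus cd_add_zero cd_minus_closed cd_zero_add)

lemma cd_add_self: "x \<in> cd_algebra n \<Longrightarrow> x + x = 2 *\<^sub>R x"
  by (induction n arbitrary: x) fastforce+

lemma cd_scaleR_zero [simp]: "t *\<^sub>R cd_zero n = cd_zero n"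
  by (induction n) auto

lemma cd_zero_scaleR: "x \<in> cd_algebra n \<Longrightarrow> 0 *\<^sub>R x = cd_zero n"
  by (induction n arbitrary: x) fastforce+

lemma cd_one_scaleR: "1 *\<^sub>R x = (x :: cd)"
  by (induction x) auto

lemma cd_scaleR_scaleR: "s *\<^sub>R t *\<^sub>R x = (s * t) *\<^sub>R (x :: cd)"
  by (induction x) auto

lemma cd_scaleR_minus: "t *\<^sub>R (- x) = (- t) *\<^sub>R (x :: cd)"
  by (induction x) auto

section \<open>Multiplication and involution\<close>

lemma cd_conj_conj [simp]: "cd_conj (cd_conj x) = x"
  by (induction x) auto

lemma cd_conj_minus [simp]: "cd_conj (- x) = - cd_conj x"
  by (induction x) auto

lemma cd_conj_zero [simp]: "cd_conj (cd_zero n) = cd_zero n"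
  by (induction n) auto

lemma cd_conj_one [simp]: "cd_conj (cd_one n) = cd_one n"
  by (induction n) auto

lemma cd_conj_add:
  "x \<in> cd_algebra n \<Longrightarrow> y \<in> cd_algebra n \<Longrightarrow> cd_conj (x + y) = cd_conj x + cd_conj y"
proof (induction n arbitrary: x y)
  case (Suc n)
  then show ?case by (auto simp: cd_minus_distrib[of _ n])
qed auto

text \<open>The product of pairs puts components of its right factor on either side, so each law for
  pairs rests on both laws one level below; hence the joint induction.\<close>

lemma cd_distrib:
  assumes "x \<in> cd_algebra n" "y \<in> cd_algebra n" "z \<in> cd_algebra n"
  shows "(x + y) * z = x * z + y * z" "z * (x + y) = z * x + z * y"
  using assms
proof (induction n arbitrary: x y z)
  case (Suc n)
  note ac = cd_add_commute cd_add_assoc[of _ n] cd_add_left_commute[of _ n]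
  case 1
  then show ?case
    by (auto simp: Suc.IH minus_cd_def cd_minus_distrib[of _ n] cd_conj_add[of _ n] ac)
  case 2
  then show ?case
    by (auto simp: Suc.IH minus_cd_def cd_minus_distrib[of _ n] cd_conj_add[of _ n] ac)
qed (auto simp: algebra_simps)

lemma cd_zero_times [simp]: "x \<in> cd_algebra n \<Longrightarrow> cd_zero n * x = cd_zero n"
  and cd_times_zero [simp]: "x \<in> cd_algebra n \<Longrightarrow> x * cd_zero n = cd_zero n"
  by (induction n arbitrary: x) (fastforce simp: minus_cd_def)+

lemma cd_minus_times:
  assumes "x \<in> cd_algebra n" "y \<in> cd_algebra n"
  shows "- x * y = - (x * y)"
  by (rule cd_eq_minus_if_add_zero[of _ n])
    (use assms in \<open>simp_all add: cd_distrib(1)[of _ n, symmetric] cd_minus_add[of _ n]\<close>)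

lemma cd_times_minus:
  assumes "x \<in> cd_algebra n" "y \<in> cd_algebra n"
  shows "x * - y = - (x * y)"
  by (rule cd_eq_minus_if_add_zero[of _ n])
    (use assms in \<open>simp_all add: cd_distrib(2)[of _ n, symmetric] cd_minus_add[of _ n]\<close>)

lemma cd_one_times [simp]: "x \<in> cd_algebra n \<Longrightarrow> cd_one n * x = x"
  and cd_times_one [simp]: "x \<in> cd_algebra n \<Longrightarrow> x * cd_one n = x"
proof (induction n arbitrary: x)
  case (Suc n)
  case 1
  then show ?case by (auto simp: minus_cd_def Suc.IH)
  case 2
  then show ?case by (auto simp: minus_cd_def Suc.IH)
qed auto

lemma cd_conj_times:
  "x \<in> cd_algebra n \<Longrightarrow> y \<in> cd_algebra n \<Longrightarrow> cd_conj (x * y) = cd_conj y * cd_conj x"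
proof (induction n arbitrary: x y)
  case (Suc n)
  then show ?case
    by (auto simp: minus_cd_def cd_conj_add[of _ n] cd_minus_distrib[of _ n]
        cd_minus_times[of _ n] cd_times_minus[of _ n] cd_add_commute)
qed auto

lemma cd_conj_times_self: "x \<in> cd_algebra n \<Longrightarrow> cd_conj x * x = x * cd_conj x"
proof (induction n arbitrary: x)
  case (Suc n)
  then show ?case
    by (auto simp: minus_cd_def cd_minus_times[of _ n] cd_times_minus[of _ n]
        cd_add_minus[of _ n] cd_minus_add[of _ n])
qed auto

section \<open>The real part as an associative trace\<close>

primrec cd_re :: "cd \<Rightarrow> real" where
  "cd_re (CD_Real r) = r"
| "cd_re (CD_Pair x y) = cd_re x"

lemma cd_re_add [simp]: "x \<in> cd_algebra n \<Longrightarrow> y \<in> cd_algebra n \<Longrightarrow> cd_re (x + y) = cd_re x + cd_re y"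
  by (induction n arbitrary: x y) fastforce+

lemma cd_re_minus [simp]: "cd_re (- x) = - cd_re x"
  by (induction x) auto

lemma cd_re_conj [simp]: "cd_re (cd_conj x) = cd_re x"
  by (induction x) auto

lemma cd_re_zero [simp]: "cd_re (cd_zero n) = 0"
  by (induction n) auto

lemma cd_re_one [simp]: "cd_re (cd_one n) = 1"
  by (induction n) auto

text \<open>The involution negates every leaf except the leftmost one, which is the coordinate along
  \<open>cd_one n\<close> read by \<open>cd_re\<close>.\<close>

lemma cd_add_conj: "x \<in> cd_algebra n \<Longrightarrow> x + cd_conj x = (2 * cd_re x) *\<^sub>R cd_one n"
proof (induction n arbitrary: x)
  case (Suc n)
  then show ?case by (auto simp: cd_add_minus[of _ n])
qed auto

lemma cd_conj_eq_minus:
  assumes "x \<in> cd_algebra n" "cd_re x = 0"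
  shows "cd_conj x = - x"
  by (rule cd_eq_minus_if_add_zero[of _ n])
    (use assms in \<open>simp_all add: cd_add_commute cd_add_conj[of _ n] cd_zero_scaleR[of _ n]\<close>)

text \<open>Swapping two pairs turns the term \<open>cd_conj d * b\<close> into
  \<open>cd_conj b * d\<close>, its image under the involution, and \<open>cd_re\<close> does not
  see the involution.\<close>

lemma cd_re_commute:
  "x \<in> cd_algebra n \<Longrightarrow> y \<in> cd_algebra n \<Longrightarrow> cd_re (x * y) = cd_re (y * x)"
proof (induction n arbitrary: x y)
  case (Suc n)
  have "cd_re (cd_conj p * q) = cd_re (cd_conj q * p)"
    if "p \<in> cd_algebra n" "q \<in> cd_algebra n" for p q
    using that by (metis cd_re_conj cd_conj_times cd_conj_closed cd_conj_conj)
  with Suc show ?case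
    by (auto simp: minus_cd_def cd_re_add[of _ n])
qed auto

text \<open>Expanded over pairs, both sides become the same four triple products up to bracketing
  and cyclic rotation, which do not affect the trace one level below.\<close>

lemma cd_re_assoc:
  "x \<in> cd_algebra n \<Longrightarrow> y \<in> cd_algebra n \<Longrightarrow> z \<in> cd_algebra n \<Longrightarrow>
    cd_re ((x * y) * z) = cd_re (x * (y * z))"
proof (induction n arbitrary: x y z)
  case (Suc n)
  \<comment> \<open>Symmetry of the trace moves \<open>r\<close> to the front, and the induction
    hypothesis then moves the bracket.\<close>
  have rot: "cd_re ((p * q) * r) = cd_re ((r * p) * q)"
    if "p \<in> cd_algebra n" "q \<in> cd_algebra n" "r \<in> cd_algebra n" for p q r
    using that Suc.IH[of r p q] cd_re_commute[of "p * q" n r] by simp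
  from Suc.prems obtain p q r s t u where
    x: "x = CD_Pair p q" and y: "y = CD_Pair r s" and z: "z = CD_Pair t u"
    and mem: "p \<in> cd_algebra n" "q \<in> cd_algebra n" "r \<in> cd_algebra n"
      "s \<in> cd_algebra n" "t \<in> cd_algebra n" "u \<in> cd_algebra n"
    by auto
  have "cd_re (p * r * t) = cd_re (p * (r * t))"
    "cd_re (cd_conj s * q * t) = cd_re (t * cd_conj s * q)"
    "cd_re (cd_conj u * (s * p)) = cd_re (p * (cd_conj u * s))"
    "cd_re (cd_conj u * (q * cd_conj r)) = cd_re (cd_conj r * cd_conj u * q)"
    using mem Suc.IH rot cd_re_commute by (simp, simp, metis cd_conj_closed, metis cd_conj_closed)
  with mem show ?case
    by (simp add: x y z minus_cd_def cd_re_add[of _ n] cd_distrib[of _ n] cd_conj_add[of _ n]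
        cd_conj_times[of _ n] cd_minus_times[of _ n] cd_times_minus[of _ n])
qed auto

text \<open>The summand \<open>y * cd_conj x\<close> is the conjugate of
  \<open>x * cd_conj y\<close>, so their sum is twice a real part. Orthogonality thus becomes the
  vanishing of one trace.\<close>

lemma cd_inner_eq:
  assumes "x \<in> cd_algebra n" "y \<in> cd_algebra n"
  shows "cd_inner x y = cd_re (x * cd_conj y) *\<^sub>R cd_one n"
  using assms cd_add_conj[of "x * cd_conj y" n]
  by (simp add: cd_inner_def cd_conj_times[of _ n] cd_scaleR_scaleR)

lemma cd_times_conj: "x \<in> cd_algebra n \<Longrightarrow> x * cd_conj x = cd_re (x * cd_conj x) *\<^sub>R cd_one n"
  using cd_inner_eq[of x n x] cd_add_self[of "x * cd_conj x" n]
  by (simp add: cd_inner_def cd_scaleR_scaleR cd_one_scaleR)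

lemma cd_inner_commute: "cd_inner x y = cd_inner y x"
  by (simp add: cd_inner_def cd_add_commute)

text \<open>The first component of the product contributes \<open>cd_conj s * q\<close>; symmetry of
  the trace turns it into \<open>q * cd_conj s\<close>, so the components contribute
  independently.\<close>

lemma cd_inner_Pair:
  assumes "p \<in> cd_algebra n" "q \<in> cd_algebra n" "r \<in> cd_algebra n" "s \<in> cd_algebra n"
  shows "cd_inner (CD_Pair p q) (CD_Pair r s) =
    (cd_re (p * cd_conj r) + cd_re (q * cd_conj s)) *\<^sub>R cd_one (Suc n)"
  using assms cd_re_commute[of q n "cd_conj s"]
  by (subst cd_inner_eq[of _ "Suc n"])
    (auto simp: minus_cd_def cd_re_add[of _ n] cd_minus_times[of _ n])

text \<open>By symmetry of the inner product only positions \<open>i < j\<close> matter, and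
  \<open>sorted_wrt\<close> unfolds to exactly these pairs on an explicit list.\<close>

lemma cd_orthogonal_systemI:
  assumes "set xs \<subseteq> cd_algebra n" "cd_zero n \<notin> set xs"
    and "sorted_wrt (\<lambda>x y. cd_inner x y = cd_zero n) xs"
  shows "cd_orthogonal_system n xs"
  unfolding cd_orthogonal_system_def
  using assms sorted_wrt_nth_less[OF assms(3)] by (metis cd_inner_commute linorder_neqE_nat)

lemma cd_nonzero: "x * x = - cd_one n \<Longrightarrow> x \<in> cd_algebra n \<Longrightarrow> x \<noteq> cd_zero n"
  by (metis cd_minus_minus cd_minus_zero cd_re_one cd_re_zero cd_times_zero zero_neq_one)

lemma cd_one_neq_zero: "cd_one n \<noteq> cd_zero n"
  using cd_re_one[of n] by force

section \<open>Purely imaginary units\<close>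

text \<open>On elements of real part 0 the involution is negation, so the condition on the square is
  norm 1, stated as a usable rewrite rule.\<close>

definition imag_unit :: "nat \<Rightarrow> cd \<Rightarrow> bool" where
  "imag_unit n x \<longleftrightarrow> x \<in> cd_algebra n \<and> cd_re x = 0 \<and> x * x = - cd_one n"

lemma imag_unitI:
  "x \<in> cd_algebra n \<Longrightarrow> cd_re x = 0 \<Longrightarrow> x * cd_conj x = cd_one n \<Longrightarrow> imag_unit n x"
  using cd_conj_eq_minus[of x n] cd_times_minus[of x n x]
  by (metis cd_minus_minus imag_unit_def)

lemma imag_unit_conj: "imag_unit n x \<Longrightarrow> cd_conj x = - x"
  by (auto simp: imag_unit_def intro: cd_conj_eq_minus)

text \<open>The product is purely imaginary, so the involution negates it; the involution also
  reverses its factors, and their two signs cancel.\<close>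

lemma imag_unit_anticommute:
  assumes "imag_unit n x" "imag_unit n y" "cd_re (x * y) = 0"
  shows "y * x = - (x * y)"
proof -
  have "- (x * y) = cd_conj (x * y)"
    using assms cd_conj_eq_minus[of "x * y" n] by (simp add: imag_unit_def)
  also have "\<dots> = y * x"
    using assms by (simp add: imag_unit_def cd_conj_times[of _ n] imag_unit_conj[OF assms(1)]
        imag_unit_conj[OF assms(2)] cd_minus_times[of _ n] cd_times_minus[of _ n])
  finally show ?thesis by simp
qed

lemma imag_unit_alternate:
  assumes "imag_unit n x" "imag_unit n y" "alternate_strongly x y"
  shows "x * (x * y) = - y" "(y * x) * x = - y" "y * (y * x) = - x" "(x * y) * y = - x"
proof -
  have mem: "x \<in> cd_algebra n" "y \<in> cd_algebra n"
    using assms by (auto simp: imag_unit_def)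
  show *: "x * (x * y) = - y" "y * (y * x) = - x"
    using assms by (auto simp: imag_unit_def alternate_strongly_def cd_minus_times[of _ n])
  \<comment> \<open>The involution reverses products, so left alternation yields right
    alternation.\<close>
  show "(y * x) * x = - y" "(x * y) * y = - x"
    using arg_cong[OF *(1), of cd_conj] arg_cong[OF *(2), of cd_conj] mem
    by (simp_all add: cd_conj_times[of _ n] imag_unit_conj[OF assms(1)] imag_unit_conj[OF assms(2)]
        cd_minus_times[of _ n] cd_times_minus[of _ n]) (metis cd_minus_minus)+
qed

section \<open>Zero divisors with strongly alternating components\<close>

locale alternating_zero_divisors =
  fixes n :: nat and a b c d :: cd
  assumes mem: "a \<in> cd_algebra n" "b \<in> cd_algebra n" "c \<in> cd_algebra n" "d \<in> cd_algebra n"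
    and alternate: "alternate_strongly a c" "alternate_strongly a d"
      "alternate_strongly b c" "alternate_strongly b d"
    and zero_product: "CD_Pair a b * CD_Pair c d = cd_zero (Suc n)"
    and norm: "a * cd_conj a = cd_one n" "b * cd_conj b = cd_one n"
      "c * cd_conj c = cd_one n" "d * cd_conj d = cd_one n"
begin

section \<open>Relations contained in the vanishing product\<close>

lemma norm': "cd_conj a * a = cd_one n" "cd_conj b * b = cd_one n"
  "cd_conj c * c = cd_one n" "cd_conj d * d = cd_one n"
  using mem norm by (simp_all add: cd_conj_times_self[of _ n])

lemma ac_eq_conj: "a * c = cd_conj d * b"
  using zero_product mem cd_eq_minus_if_add_zero[of "a * c" n "- (cd_conj d * b)"]
  by (simp add: minus_cd_def)

lemma da_eq_conj: "d * a = - (b * cd_conj c)"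
  using zero_product mem cd_eq_minus_if_add_zero[of "d * a" n "b * cd_conj c"]
  by simp

lemma conj_ad_eq: "cd_conj a * cd_conj d = - (c * cd_conj b)"
  using arg_cong[OF da_eq_conj, of cd_conj] mem by (simp add: cd_conj_times[of _ n])

text \<open>Each real part is shown to equal its own negative: a factor of norm 1 is inserted next
  to its conjugate, the trace is rebracketed, and the two components of the vanishing product supply
  exactly one minus sign.\<close>

lemma imag_units: "imag_unit n a" "imag_unit n b" "imag_unit n c" "imag_unit n d"
proof -
  note re = cd_re_assoc[of _ n]
  have "cd_re a = cd_re ((a * c) * cd_conj c)"
    using mem norm by (simp add: re)
  also have "\<dots> = - cd_re (cd_conj d * (d * a))"
    using mem by (simp add: re ac_eq_conj da_eq_conj cd_times_minus[of _ n])
  also have "\<dots> = - cd_re a"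
    using mem norm' by (simp flip: re)
  finally show "imag_unit n a" using mem norm by (simp add: imag_unitI)
  have "cd_re b = cd_re (d * (a * c))"
    using mem norm by (simp add: ac_eq_conj flip: re)
  also have "\<dots> = - cd_re ((b * cd_conj c) * c)"
    using mem by (simp add: da_eq_conj cd_minus_times[of _ n] flip: re)
  also have "\<dots> = - cd_re b"
    using mem norm' by (simp add: re)
  finally show "imag_unit n b" using mem norm by (simp add: imag_unitI)
  have "cd_re c = cd_re (cd_conj a * (a * c))"
    using mem norm' by (simp flip: re)
  also have "\<dots> = cd_re ((cd_conj a * cd_conj d) * b)"
    using mem by (simp add: ac_eq_conj re)
  also have "\<dots> = - cd_re ((c * cd_conj b) * b)"
    using mem by (simp add: conj_ad_eq cd_minus_times[of _ n])
  also have "\<dots> = - cd_re c"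
    using mem norm' by (simp add: re)
  finally show "imag_unit n c" using mem norm by (simp add: imag_unitI)
  have "cd_re d = cd_re ((a * c) * cd_conj b)"
    using mem norm by (simp add: ac_eq_conj re)
  also have "\<dots> = cd_re (a * (c * cd_conj b))"
    using mem by (simp add: re)
  also have "c * cd_conj b = - (cd_conj a * cd_conj d)"
    by (simp add: conj_ad_eq)
  also have "cd_re (a * - (cd_conj a * cd_conj d)) = - cd_re d"
    using mem norm by (simp add: cd_times_minus[of _ n] flip: re)
  finally show "imag_unit n d" using mem norm by (simp add: imag_unitI)
qed

lemmas conjs = imag_units[THEN imag_unit_conj]

lemma ac_eq: "a * c = - (d * b)"
  using ac_eq_conj mem by (simp add: conjs cd_minus_times[of _ n])

lemma da_eq: "d * a = b * c"
  using da_eq_conj mem by (simp add: conjs cd_times_minus[of _ n])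

lemma ad_eq: "a * d = c * b"
  using conj_ad_eq mem by (simp add: conjs cd_minus_times[of _ n] cd_times_minus[of _ n])

lemmas alternates =
  imag_unit_alternate[OF imag_units(1) imag_units(3) alternate(1)]
  imag_unit_alternate[OF imag_units(1) imag_units(4) alternate(2)]
  imag_unit_alternate[OF imag_units(2) imag_units(3) alternate(3)]
  imag_unit_alternate[OF imag_units(2) imag_units(4) alternate(4)]

text \<open>
  In each case the real part of a product of four of the elements is evaluated in two ways: the
  relations between the products \<open>ac\<close>, \<open>db\<close> and \<open>da\<close>, \<open>bc\<close> change which factors meet.
\<close>

lemma re_products:
  "cd_re (a * b) = 0" "cd_re (d * c) = 0" "cd_re (a * c) = 0" "cd_re (a * d) = 0"
proof -
  note re = cd_re_assoc[of _ n] and comm = cd_re_commute[of _ n]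
    and minus = cd_minus_times[of _ n] cd_times_minus[of _ n]
  have "cd_re (a * b) = - cd_re (a * (c * (c * b)))"
    using mem by (simp add: alternates minus)
  also have "\<dots> = - cd_re ((a * c) * (a * d))"
    using mem by (simp add: re ad_eq)
  also have "\<dots> = cd_re ((a * d) * (d * b))"
    using mem comm[of "a * d" "d * b"] by (simp add: ac_eq minus)
  also have "\<dots> = - cd_re (a * b)"
    using mem by (simp add: re alternates minus)
  finally show "cd_re (a * b) = 0" by simp
  have "cd_re (d * c) = - cd_re (d * (a * (a * c)))"
    using mem by (simp add: alternates minus)
  also have "\<dots> = - cd_re ((d * a) * (a * c))"
    using mem by (simp add: re)
  also have "\<dots> = cd_re ((d * b) * (b * c))"
    using mem comm[of "b * c" "d * b"] by (simp add: ac_eq da_eq minus)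
  also have "\<dots> = - cd_re (d * c)"
    using mem by (simp add: re alternates minus)
  finally show "cd_re (d * c) = 0" by simp
  have "cd_re (a * c) = - cd_re ((a * b) * (b * c))"
    using mem by (simp add: re alternates minus)
  also have "\<dots> = - cd_re (((d * a) * a) * b)"
    using mem comm[of "a * b" "d * a"] by (simp add: re flip: da_eq)
  also have "\<dots> = - cd_re (a * c)"
    using mem by (simp add: ac_eq alternates minus)
  finally show "cd_re (a * c) = 0" by simp
  have "cd_re (d * a) = - cd_re ((b * a) * (a * c))"
    using mem by (simp add: re alternates minus da_eq)
  also have "\<dots> = cd_re (((d * b) * b) * a)"
    using mem comm[of "b * a" "d * b"] by (simp add: ac_eq re minus)
  also have "\<dots> = - cd_re (d * a)"
    using mem by (simp add: alternates minus)
  finally show "cd_re (a * d) = 0" using mem comm[of a d] by simp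
qed

section \<open>Products of the six components \<open>a\<close>, \<open>b\<close>, \<open>c\<close>,
  \<open>d\<close>, \<open>a * c\<close>, \<open>a * d\<close>\<close>

lemma ba_eq: "b * a = - (a * b)"
  by (rule imag_unit_anticommute[of n]) (simp_all add: imag_units re_products)

lemma cd_eq: "c * d = - (d * c)"
  by (rule imag_unit_anticommute[of n]) (simp_all add: imag_units re_products)

lemma ca_eq: "c * a = - (a * c)"
  by (rule imag_unit_anticommute[of n]) (simp_all add: imag_units re_products)

lemma da_eq_ad: "d * a = - (a * d)"
  by (rule imag_unit_anticommute[of n]) (simp_all add: imag_units re_products)

lemma bc_eq: "b * c = - (a * d)" and cb_eq: "c * b = a * d" and db_eq: "d * b = - (a * c)"
  by (simp_all add: ac_eq da_eq_ad flip: ad_eq da_eq)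

text \<open>Orthogonality of \<open>b\<close> and \<open>d\<close> is inherited from
  \<open>a\<close> and \<open>c\<close>, since \<open>d * b = - (a * c)\<close>.\<close>

lemma bd_eq: "b * d = a * c"
  using imag_unit_anticommute[OF imag_units(4) imag_units(2)] by (simp add: db_eq re_products)

text \<open>Oriented so that every product of two distinct elements among \<open>a\<close>,
  \<open>b\<close>, \<open>c\<close>, \<open>d\<close> reduces, up to sign, to \<open>a * b\<close>,
  \<open>d * c\<close>, \<open>a * c\<close> or \<open>a * d\<close>, the forms in which the table
  is written.\<close>

lemmas pair_products = bc_eq cb_eq db_eq bd_eq ba_eq cd_eq ca_eq da_eq_ad

text \<open>These are the alternation rules with the inner product replaced by its normal form:
  \<open>b * (b * c) = - c\<close>, for instance, becomes \<open>b * (a * d) = c\<close> because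
  \<open>b * c = - (a * d)\<close>.\<close>

lemma triple_products:
  "a * (a * c) = - c" "(a * c) * a = c" "a * (a * d) = - d" "(a * d) * a = d"
  "b * (a * c) = - d" "(a * c) * b = d" "b * (a * d) = c" "(a * d) * b = - c"
  "c * (a * c) = a" "(a * c) * c = - a" "c * (a * d) = - b" "(a * d) * c = b"
  "d * (a * c) = b" "(a * c) * d = - b" "d * (a * d) = a" "(a * d) * d = - a"
  using alternates[unfolded pair_products] mem
  by (simp_all add: cd_minus_times[of _ n] cd_times_minus[of _ n] cd_eq_minus_iff)

text \<open>The norm is a real multiple of the unity, so its real part determines it; rebracketing
  under the trace gives \<open>cd_re (a * (c * (a * c))) = cd_re (a * a) = - 1\<close>, and likewise
  for \<open>a * d\<close>.\<close>

lemma imag_unit_ac: "imag_unit n (a * c)" and imag_unit_ad: "imag_unit n (a * d)"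
proof -
  have *: "cd_re ((a * c) * (a * c)) = - 1" "cd_re ((a * d) * (a * d)) = - 1"
    using mem imag_units
    by (simp_all add: cd_re_assoc[of _ n] triple_products imag_unit_def)
  have conj: "cd_conj (a * c) = - (a * c)" "cd_conj (a * d) = - (a * d)"
    using mem re_products by (auto intro!: cd_conj_eq_minus[of _ n])
  show "imag_unit n (a * c)" "imag_unit n (a * d)"
    using mem re_products * cd_times_conj[of "a * c" n] cd_times_conj[of "a * d" n]
    by (auto intro!: imag_unitI simp: conj cd_times_minus[of _ n] cd_one_scaleR)
qed

text \<open>Rebracketing under the trace and \<open>c * (a * d) = - b\<close> reduce this to the
  orthogonality of \<open>a\<close> and \<open>b\<close>.\<close>

lemma re_ac_ad: "cd_re ((a * c) * (a * d)) = 0"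
  using mem re_products by (simp add: cd_re_assoc[of _ n] triple_products cd_times_minus[of _ n])

lemma ad_ac_eq: "(a * d) * (a * c) = - ((a * c) * (a * d))"
  by (rule imag_unit_anticommute[of n]) (simp_all add: imag_unit_ac imag_unit_ad re_ac_ad)

lemma squares: "a * a = - cd_one n" "b * b = - cd_one n" "c * c = - cd_one n" "d * d = - cd_one n"
    "(a * c) * (a * c) = - cd_one n" "(a * d) * (a * d) = - cd_one n"
  using imag_units imag_unit_ac imag_unit_ad by (simp_all add: imag_unit_def)

lemmas products = pair_products triple_products ad_ac_eq squares

end

section \<open>The orthogonal system of pairs and its multiplication table\<close>

theorem theorem4p11:
  fixes n :: nat and a b c d :: cd and f g :: "nat \<Rightarrow> cd"
  assumes "a \<in> cd_algebra n" and "b \<in> cd_algebra n"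
    and "c \<in> cd_algebra n" and "d \<in> cd_algebra n"
    and "alternate_strongly a c" and "alternate_strongly a d"
    and "alternate_strongly b c" and "alternate_strongly b d"
    and "CD_Pair a b * CD_Pair c d = cd_zero (Suc n)"
    and "cd_norm a = cd_one n" and "cd_norm b = cd_one n"
    and "cd_norm c = cd_one n" and "cd_norm d = cd_one n"
    and "f 0 = CD_Pair (cd_one n) (cd_zero n)" and "g 0 = CD_Pair (cd_zero n) (cd_one n)"
    and "f 1 = CD_Pair a b" and "g 1 = CD_Pair (- b) a"
    and "f 2 = CD_Pair c (- d)" and "g 2 = CD_Pair d c"
    and "f 3 = CD_Pair (a * c) (a * d)" and "g 3 = CD_Pair (- (a * d)) (a * c)"
    and "f 4 = CD_Pair (a * c) (- (a * d))" and "g 4 = CD_Pair (a * d) (a * c)"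
    and "f 5 = CD_Pair c d" and "g 5 = CD_Pair (- d) c"
    and "f 6 = CD_Pair a (- b)" and "g 6 = CD_Pair b a"
    and "f 7 = CD_Pair (cd_zero n) (a * b)" and "g 7 = CD_Pair (- (a * b)) (cd_zero n)"
    and "f 8 = CD_Pair (cd_zero n) (d * c)" and "g 8 = CD_Pair (- (d * c)) (cd_zero n)"
    and "f 9 = CD_Pair (cd_zero n) ((a * c) * (a * d))"
    and "g 9 = CD_Pair (- ((a * c) * (a * d))) (cd_zero n)"
  shows "cd_orthogonal_system (Suc n) (map f [0..<7] @ map g [0..<7]) \<and>
    (let F = map f [0..<7] @ map g [0..<7]; z = cd_zero (Suc n) in
      map (\<lambda>x. map (\<lambda>y. x * y) F) F =
       [
        [f 0, f 1, f 2, f 3, f 4, f 5, f 6,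
         g 0, g 1, g 2, g 3, g 4, g 5, g 6],
        [f 1, (-2) *\<^sub>R f 0, 2 *\<^sub>R f 3, (-2) *\<^sub>R f 2, z, z, 2 *\<^sub>R f 7,
         g 1, (-2) *\<^sub>R g 0, (-2) *\<^sub>R g 3, 2 *\<^sub>R g 2, z, z, (-2) *\<^sub>R g 7],
        [f 2, (-2) *\<^sub>R f 3, (-2) *\<^sub>R f 0, 2 *\<^sub>R f 1, z, 2 *\<^sub>R f 8, z,
         g 2, 2 *\<^sub>R g 3, (-2) *\<^sub>R g 0, (-2) *\<^sub>R g 1, z, (-2) *\<^sub>R g 8, z],
        [f 3, 2 *\<^sub>R f 2, (-2) *\<^sub>R f 1, (-2) *\<^sub>R f 0, 2 *\<^sub>R f 9, z, z,
         g 3, (-2) *\<^sub>R g 2, 2 *\<^sub>R g 1, (-2) *\<^sub>R g 0, (-2) *\<^sub>R g 9, z, z],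
        [f 4, z, z, (-2) *\<^sub>R f 9, (-2) *\<^sub>R f 0, (-2) *\<^sub>R f 6, 2 *\<^sub>R f 5,
         g 4, z, z, 2 *\<^sub>R g 9, (-2) *\<^sub>R g 0, 2 *\<^sub>R g 6, (-2) *\<^sub>R g 5],
        [f 5, z, (-2) *\<^sub>R f 8, z, 2 *\<^sub>R f 6, (-2) *\<^sub>R f 0, (-2) *\<^sub>R f 4,
         g 5, z, 2 *\<^sub>R g 8, z, (-2) *\<^sub>R g 6, (-2) *\<^sub>R g 0, 2 *\<^sub>R g 4],
        [f 6, (-2) *\<^sub>R f 7, z, z, (-2) *\<^sub>R f 5, 2 *\<^sub>R f 4, (-2) *\<^sub>R f 0,
         g 6, 2 *\<^sub>R g 7, z, z, 2 *\<^sub>R g 5, (-2) *\<^sub>R g 4, (-2) *\<^sub>R g 0],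
        [g 0, - g 1, - g 2, - g 3, - g 4, - g 5, - g 6,
         - f 0, f 1, f 2, f 3, f 4, f 5, f 6],
        [g 1, 2 *\<^sub>R g 0, (-2) *\<^sub>R g 3, 2 *\<^sub>R g 2, z, z, (-2) *\<^sub>R g 7,
         - f 1, (-2) *\<^sub>R f 0, (-2) *\<^sub>R f 3, 2 *\<^sub>R f 2, z, z, (-2) *\<^sub>R f 7],
        [g 2, 2 *\<^sub>R g 3, 2 *\<^sub>R g 0, (-2) *\<^sub>R g 1, z, (-2) *\<^sub>R g 8, z,
         - f 2, 2 *\<^sub>R f 3, (-2) *\<^sub>R f 0, (-2) *\<^sub>R f 1, z, (-2) *\<^sub>R f 8, z],
        [g 3, (-2) *\<^sub>R g 2, 2 *\<^sub>R g 1, 2 *\<^sub>R g 0, (-2) *\<^sub>R g 9, z, z,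
         - f 3, (-2) *\<^sub>R f 2, 2 *\<^sub>R f 1, (-2) *\<^sub>R f 0, (-2) *\<^sub>R f 9, z, z],
        [g 4, z, z, 2 *\<^sub>R g 9, 2 *\<^sub>R g 0, 2 *\<^sub>R g 6, (-2) *\<^sub>R g 5,
         - f 4, z, z, 2 *\<^sub>R f 9, (-2) *\<^sub>R f 0, 2 *\<^sub>R f 6, (-2) *\<^sub>R f 5],
        [g 5, z, 2 *\<^sub>R g 8, z, (-2) *\<^sub>R g 6, 2 *\<^sub>R g 0, 2 *\<^sub>R g 4,
         - f 5, z, 2 *\<^sub>R f 8, z, (-2) *\<^sub>R f 6, (-2) *\<^sub>R f 0, 2 *\<^sub>R f 4],
        [g 6, 2 *\<^sub>R g 7, z, z, 2 *\<^sub>R g 5, (-2) *\<^sub>R g 4, 2 *\<^sub>R g 0,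
         - f 6, 2 *\<^sub>R f 7, z, z, 2 *\<^sub>R f 5, (-2) *\<^sub>R f 4, (-2) *\<^sub>R f 0]
       ])"
proof -
  interpret alternating_zero_divisors n a b c d
    using assms(1-13) by unfold_locales (simp_all add: cd_norm_def)
  note minus = minus_cd_def cd_minus_times[of _ n] cd_times_minus[of _ n]
  note defs = assms(14-33)
  have conj: "cd_conj (a * c) = - (a * c)" "cd_conj (a * d) = - (a * d)"
    using imag_unit_ac imag_unit_ad by (simp_all add: imag_unit_conj)
  have re0: "cd_re a = 0" "cd_re b = 0" "cd_re c = 0" "cd_re d = 0"
    using imag_units by (simp_all add: imag_unit_def)
  let ?F = "map f [0..<7] @ map g [0..<7]"
  have F: "?F = [f 0, f 1, f 2, f 3, f 4, f 5, f 6, g 0, g 1, g 2, g 3, g 4, g 5, g 6]"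
    by (simp add: upt_rec numeral_eq_Suc)
  have "cd_orthogonal_system (Suc n) ?F"
  proof (rule cd_orthogonal_systemI)
    show "set ?F \<subseteq> cd_algebra (Suc n)"
      unfolding F defs by (simp add: mem)
    \<comment> \<open>Every member has a component that is, up to sign, the unity or an element of
      square \<open>- cd_one n\<close>, hence nonzero.\<close>
    show "cd_zero (Suc n) \<notin> set ?F"
      unfolding F defs using mem squares[THEN cd_nonzero] cd_one_neq_zero[of n] by auto
    \<comment> \<open>Usually both component traces vanish. For pairs differing only in the sign of
      one component, such as \<open>f 1\<close> and \<open>f 6\<close>, they are 1 and -1 up to
      order and cancel.\<close>
    show "sorted_wrt (\<lambda>x y. cd_inner x y = cd_zero (Suc n)) ?F"
      unfolding F defs
      by (simp add: mem cd_inner_Pair[of _ n] conjs conj minus products re0 re_products re_ac_ad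
          cd_zero_scaleR[of _ n])
  qed
  \<comment> \<open>Away from the rows and columns of \<open>f 0\<close> and \<open>g 0\<close>, the
    two terms in each component of a product agree up to sign, so they double or cancel; this is the
    source of the entries with factor 2 and of the zeros.\<close>
  then show ?thesis
    unfolding Let_def F defs
    by (simp add: mem conjs conj minus products cd_add_self[of _ n] cd_add_minus[of _ n]
        cd_minus_add[of _ n] cd_scaleR_minus)
qed

end
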